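(* Let $(W,S)$ be a Coxeter system and $(X,\mathrm{ht})$ a quasiparabolic $W$-set. Let $T(X)$ be the free $\mathbb Z[q]$-module with basis $T(x)$, $x\in X$, with the bilinear pairing (with values in $\mathbb Z[q,q^{-1}]$) determined by $\langle T(x),T(y)\rangle=\delta_{xy}q^{\mathrm{ht}(x)}$. Then for each $s\in S$ and each choice of sign $\pm$, the linear transformation $T_\pm(s)$ of $T(X)$ is self-adjoint with respect to this pairing: $\langle T_\pm(s)u,v\rangle=\langle u,T_\pm(s)v\rangle$ for all $u,v\in T(X)$.
   Context: Coxeter systems $(W,S)$ have finite rank; $R(W)$ is the set of reflections, i.e. conjugates in $W$ of elements of $S$. A scaled $W$-set is a pair $(X,\mathrm{ht})$ with $X$ a (left) $W$-set and $\mathrm{ht}:X\to\mathbb Z$ a function with $|\mathrm{ht}(sx)-\mathrm{ht}(x)|\le 1$ for all $s\in S$, $x\in X$. A quasiparabolic $W$-set is a scaled $W$-set such that (QP1) for all $r\in R(W)$, $x\in X$, if $\mathrm{ht}(rx)=\mathrm{ht}(x)$ then $rx=x$; and (QP2) for all $r\in R(W)$, $x\in X$, $s\in S$, if $\mathrm{ht}(rx)>\mathrm{ht}(x)$ and $\mathrm{ht}(srx)<\mathrm{ht}(sx)$, then $rx=sx$. With $\epsilon_+:=q$ and $\epsilon_-:=-1$, the endomorphism $T_\pm(s)$ of $T(X)$ is defined by: $T_\pm(s)T(x)=T(sx)$ if $\mathrm{ht}(sx)>\mathrm{ht}(x)$; $T_\pm(s)T(x)=\epsilon_\pm T(x)$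 if $\mathrm{ht}(sx)=\mathrm{ht}(x)$; $T_\pm(s)T(x)=(q-1)T(x)+qT(sx)$ if $\mathrm{ht}(sx)<\mathrm{ht}(x)$. *)

theory Defs
  imports
    "HOL-Algebra.Group_Action"
    "HOL-Algebra.Generated_Groups"
    "HOL-Computational_Algebra.Polynomial"
    "HOL-Library.Poly_Mapping"
    "HOL-Library.Extended_Nat"
begin

section \<open>Group presentations and Coxeter systems\<close>

text \<open>A word is a list of signed letters: \<open>(s, True)\<close> is the letter \<open>s\<close>, and
  \<open>(s, False)\<close> is its formal inverse.\<close>

type_synonym 'w word = "('w \<times> bool) list"

primrec word_value :: "('w, 'k) monoid_scheme \<Rightarrow> 'w word \<Rightarrow> 'w" where
  "word_value W [] = \<one>\<^bsub>W\<^esub>"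
| "word_value W (a # as) = (if snd a then fst a else inv\<^bsub>W\<^esub> (fst a)) \<otimes>\<^bsub>W\<^esub> word_value W as"

text \<open>Equality of words over \<open>S\<close> in the group with generators \<open>S\<close> and relators \<open>R\<close>.\<close>

inductive pres_eq :: "'w set \<Rightarrow> 'w word set \<Rightarrow> 'w word \<Rightarrow> 'w word \<Rightarrow> bool"
  for S :: "'w set" and R :: "'w word set" where
  pres_refl: "w \<in> lists (S \<times> UNIV) \<Longrightarrow> pres_eq S R w w"
| pres_sym: "pres_eq S R u v \<Longrightarrow> pres_eq S R v u"
| pres_trans: "pres_eq S R u v \<Longrightarrow> pres_eq S R v w \<Longrightarrow> pres_eq S R u w"
| pres_cancel: "u \<in> lists (S \<times> UNIV) \<Longrightarrow> v \<in> lists (S \<times> UNIV) \<Longrightarrow> s \<in> S \<Longrightarrow>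
    pres_eq S R (u @ [(s, b), (s, \<not> b)] @ v) (u @ v)"
| pres_relator: "u \<in> lists (S \<times> UNIV) \<Longrightarrow> v \<in> lists (S \<times> UNIV) \<Longrightarrow> r \<in> R \<Longrightarrow>
    pres_eq S R (u @ r @ v) (u @ v)"

text \<open>\<open>W = \<langle>S | R\<rangle>\<close>: the subset \<open>S\<close> generates \<open>W\<close>, and a word is trivial in \<open>W\<close>
  exactly when the relators force it to be.\<close>

definition presented_by :: "('w, 'k) monoid_scheme \<Rightarrow> 'w set \<Rightarrow> 'w word set \<Rightarrow> bool" where
  "presented_by W S R \<longleftrightarrow>
     S \<subseteq> carrier W \<and> R \<subseteq> lists (S \<times> UNIV) \<and> generate W S = carrier W \<and>
     (\<forall>w \<in> lists (S \<times> UNIV). word_value W w = \<one>\<^bsub>W\<^esub> \<longleftrightarrow> pres_eq S R w [])"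

definition coxeter_matrix :: "'w set \<Rightarrow> ('w \<Rightarrow> 'w \<Rightarrow> enat) \<Rightarrow> bool" where
  "coxeter_matrix S m \<longleftrightarrow>
     (\<forall>s\<in>S. m s s = 1) \<and> (\<forall>s\<in>S. \<forall>t\<in>S. s \<noteq> t \<longrightarrow> m s t = m t s \<and> m s t \<ge> 2)"

definition coxeter_relators :: "'w set \<Rightarrow> ('w \<Rightarrow> 'w \<Rightarrow> enat) \<Rightarrow> 'w word set" where
  "coxeter_relators S m =
     {concat (replicate k [(s, True), (t, True)]) | s t k. s \<in> S \<and> t \<in> S \<and> m s t = enat k}"

locale coxeter_system = group W for W :: "('w, 'k) monoid_scheme" (structure) +
  fixes S :: "'w set"
  assumes finite_rank: "finite S"
    and presentation: "\<exists>m. coxeter_matrix S m \<and> presented_by W S (coxeter_relators S m)"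

definition reflections :: "('w, 'k) monoid_scheme \<Rightarrow> 'w set \<Rightarrow> 'w set" where
  "reflections W S = {w \<otimes>\<^bsub>W\<^esub> s \<otimes>\<^bsub>W\<^esub> inv\<^bsub>W\<^esub> w | w s. w \<in> carrier W \<and> s \<in> S}"

section \<open>Quasiparabolic sets\<close>

locale scaled_W_set = coxeter_system W S + group_action W X act
  for W :: "('w, 'k) monoid_scheme" (structure) and S :: "'w set"
    and X :: "'x set" and act :: "'w \<Rightarrow> 'x \<Rightarrow> 'x" +
  fixes ht :: "'x \<Rightarrow> int"
  assumes ht_step: "s \<in> S \<Longrightarrow> x \<in> X \<Longrightarrow> \<bar>ht (act s x) - ht x\<bar> \<le> 1"

locale quasiparabolic_W_set = scaled_W_set W S X act ht
  for W :: "('w, 'k) monoid_scheme" (structure) and S :: "'w set"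
    and X :: "'x set" and act :: "'w \<Rightarrow> 'x \<Rightarrow> 'x" and ht :: "'x \<Rightarrow> int" +
  assumes QP1: "r \<in> reflections W S \<Longrightarrow> x \<in> X \<Longrightarrow> ht (act r x) = ht x \<Longrightarrow> act r x = x"
    and QP2: "r \<in> reflections W S \<Longrightarrow> x \<in> X \<Longrightarrow> s \<in> S \<Longrightarrow>
      ht (act r x) > ht x \<Longrightarrow> ht (act s (act r x)) < ht (act s x) \<Longrightarrow> act r x = act s x"

section \<open>The module \<open>T(X)\<close>, the operators and the pairing\<close>

text \<open>Elements of \<open>T(X)\<close> are finitely supported functions with values in \<open>\<int>[q]\<close> whose
  support is contained in \<open>X\<close>.\<close>

definition T_module :: "'x set \<Rightarrow> ('x \<Rightarrow>\<^sub>0 int poly) set" where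
  "T_module X = {u. Poly_Mapping.keys u \<subseteq> X}"

definition T_basis :: "'x \<Rightarrow> ('x \<Rightarrow>\<^sub>0 int poly)" where
  "T_basis x = Poly_Mapping.single x 1"

definition T_scale :: "int poly \<Rightarrow> ('x \<Rightarrow>\<^sub>0 int poly) \<Rightarrow> ('x \<Rightarrow>\<^sub>0 int poly)" where
  "T_scale c u = Poly_Mapping.map ((*) c) u"

definition q_poly :: "int poly" where
  "q_poly = [:0, 1:]"

datatype hecke_sign = Plus | Minus

primrec eps :: "hecke_sign \<Rightarrow> int poly" where
  "eps Plus = q_poly"
| "eps Minus = - 1"

definition T_op_basis ::
  "('w \<Rightarrow> 'x \<Rightarrow> 'x) \<Rightarrow> ('x \<Rightarrow> int) \<Rightarrow> hecke_sign \<Rightarrow> 'w \<Rightarrow> 'x \<Rightarrow> ('x \<Rightarrow>\<^sub>0 int poly)" where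
  "T_op_basis act ht e s x =
     (if ht (act s x) > ht x then T_basis (act s x)
      else if ht (act s x) = ht x then T_scale (eps e) (T_basis x)
      else T_scale (q_poly - 1) (T_basis x) + T_scale q_poly (T_basis (act s x)))"

definition T_op ::
  "('w \<Rightarrow> 'x \<Rightarrow> 'x) \<Rightarrow> ('x \<Rightarrow> int) \<Rightarrow> hecke_sign \<Rightarrow> 'w \<Rightarrow> ('x \<Rightarrow>\<^sub>0 int poly) \<Rightarrow> ('x \<Rightarrow>\<^sub>0 int poly)" where
  "T_op act ht e s u =
     (\<Sum>x\<in>Poly_Mapping.keys u. T_scale (Poly_Mapping.lookup u x) (T_op_basis act ht e s x))"

text \<open>\<open>\<int>[q, q\<^sup>-\<^sup>1]\<close> is the group ring of the additive group \<open>\<int>\<close>; the product on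
  \<^typ>\<open>int \<Rightarrow>\<^sub>0 int\<close> is convolution.\<close>

type_synonym laurent = "int \<Rightarrow>\<^sub>0 int"

definition q_pow :: "int \<Rightarrow> laurent" where
  "q_pow k = Poly_Mapping.single k 1"

text \<open>The inclusion of \<open>\<int>[q]\<close>, as evaluation at \<open>q\<close>.\<close>

definition to_laurent :: "int poly \<Rightarrow> laurent" where
  "to_laurent p = poly (map_poly of_int p) (q_pow 1)"

definition pairing ::
  "('x \<Rightarrow> int) \<Rightarrow> ('x \<Rightarrow>\<^sub>0 int poly) \<Rightarrow> ('x \<Rightarrow>\<^sub>0 int poly) \<Rightarrow> laurent" where
  "pairing ht u v =
     (\<Sum>x\<in>Poly_Mapping.keys u. \<Sum>y\<in>Poly_Mapping.keys v.
        to_laurent (Poly_Mapping.lookup u x) * to_laurent (Poly_Mapping.lookup v y) *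
        (if x = y then q_pow (ht x) else 0))"

end

theory Submission
  imports Defs
begin

text \<open>In the basis \<open>T(x)\<close>, the operator is a diagonal matrix plus a matrix supported on the pairs
  \<open>(x, sx)\<close>, and the diagonal part is trivially self-adjoint. For the other part, if
  \<open>ht(sx) \<noteq> ht(x)\<close>, the two heights differ by exactly one, and the off-diagonal coefficient
  at \<open>x\<close> times \<open>q\<^bsup>ht(x)\<^esup>\<close> is \<open>q\<close> to the larger of the two heights, which is symmetric under the
  involution \<open>x \<mapsto> sx\<close>. If \<open>ht(sx) = ht(x)\<close>, then \<open>sx = x\<close> by (QP1).\<close>

lemma to_laurent_0 [simp]: "to_laurent 0 = 0"
  by (simp add: to_laurent_def)

text \<open>Horner's rule at \<open>q\<close>; the inductions below use it to show that the
  inclusion is a ring homomorphism.\<close>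

lemma to_laurent_pCons: "to_laurent (pCons a p) = of_int a + q_pow 1 * to_laurent p"
  by (simp add: to_laurent_def map_poly_pCons)

lemma to_laurent_1 [simp]: "to_laurent 1 = 1"
  by (simp add: one_pCons to_laurent_pCons)

lemma to_laurent_q [simp]: "to_laurent q_poly = q_pow 1"
  by (simp add: q_poly_def to_laurent_pCons)

lemma to_laurent_add: "to_laurent (p + r) = to_laurent p + to_laurent r"
  by (induction p r rule: poly_induct2) (simp_all add: to_laurent_pCons algebra_simps)

lemma to_laurent_smult: "to_laurent (smult a p) = of_int a * to_laurent p"
  by (induction p) (simp_all add: to_laurent_pCons algebra_simps)

lemma to_laurent_mult: "to_laurent (p * r) = to_laurent p * to_laurent r"
  by (induction p)
    (simp_all add: to_laurent_pCons to_laurent_add to_laurent_smult algebra_simps)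

lemma q_pow_add: "q_pow (i + j) = q_pow i * q_pow j"
  by (simp add: q_pow_def mult_single)

lemma lookup_T_scale [simp]: "Poly_Mapping.lookup (T_scale c u) x = c * Poly_Mapping.lookup u x"
  by (simp add: T_scale_def Poly_Mapping.map.rep_eq when_def)

lemma lookup_T_basis: "Poly_Mapping.lookup (T_basis x) y = (if x = y then 1 else 0)"
  by (simp add: T_basis_def lookup_single when_def)

text \<open>Indices outside the support of \<open>u\<close> contribute zero, so the sum may run over
  any larger finite set.\<close>

lemma lookup_T_op:
  assumes "finite A" "Poly_Mapping.keys u \<subseteq> A"
  shows "Poly_Mapping.lookup (T_op act ht e s u) y
    = (\<Sum>x\<in>A. Poly_Mapping.lookup u x
        * Poly_Mapping.lookup (T_op_basis act ht e s x) y)"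
proof -
  have "Poly_Mapping.lookup (T_op act ht e s u) y
      = (\<Sum>x\<in>Poly_Mapping.keys u. Poly_Mapping.lookup u x
        * Poly_Mapping.lookup (T_op_basis act ht e s x) y)"
    by (simp add: T_op_def lookup_sum)
  also have "\<dots> = (\<Sum>x\<in>A. Poly_Mapping.lookup u x
        * Poly_Mapping.lookup (T_op_basis act ht e s x) y)"
    using assms by (intro sum.mono_neutral_left) (auto simp: in_keys_iff)
  finally show ?thesis .
qed

text \<open>The basis is orthogonal, so the double sum collapses. Only the support of
  \<open>u\<close> has to be controlled; that of \<open>v\<close> is arbitrary.\<close>

lemma pairing_eq_left:
  assumes "finite A" "Poly_Mapping.keys u \<subseteq> A"
  shows "pairing ht u v
    = (\<Sum>x\<in>A. to_laurent (Poly_Mapping.lookup u x) * to_laurent (Poly_Mapping.lookup v x)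
        * q_pow (ht x))"
proof -
  have "(\<Sum>y\<in>Poly_Mapping.keys v. to_laurent (Poly_Mapping.lookup u x) * to_laurent (Poly_Mapping.lookup v y) *
        (if x = y then q_pow (ht x) else 0))
      = to_laurent (Poly_Mapping.lookup u x) * to_laurent (Poly_Mapping.lookup v x) * q_pow (ht x)" for x
    by (simp add: if_distrib[of "(*) _"] sum.delta' in_keys_iff cong: if_cong)
  then have "pairing ht u v
      = (\<Sum>x\<in>Poly_Mapping.keys u. to_laurent (Poly_Mapping.lookup u x) * to_laurent (Poly_Mapping.lookup v x)
        * q_pow (ht x))"
    by (simp add: pairing_def)
  also have "\<dots> = (\<Sum>x\<in>A. to_laurent (Poly_Mapping.lookup u x) * to_laurent (Poly_Mapping.lookup v x)
        * q_pow (ht x))"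
    using assms by (intro sum.mono_neutral_left) (auto simp: in_keys_iff)
  finally show ?thesis .
qed

lemma pairing_commute: "pairing ht u v = pairing ht v u"
  unfolding pairing_eq_left[of "Poly_Mapping.keys u \<union> Poly_Mapping.keys v" u, simplified]
    pairing_eq_left[of "Poly_Mapping.keys u \<union> Poly_Mapping.keys v" v, simplified]
  by (simp add: mult.commute)

context coxeter_system
begin

lemma generator_in_carrier: "s \<in> S \<Longrightarrow> s \<in> carrier W"
  using presentation by (auto simp: presented_by_def)

text \<open>The diagonal entry \<open>m s s = 1\<close> of the Coxeter matrix makes the word
  \<open>ss\<close> itself a relator.\<close>

lemma generator_square:
  assumes "s \<in> S"
  shows "s \<otimes> s = \<one>"
proof -
  obtain m where m: "coxeter_matrix S m" "presented_by W S (coxeter_relators S m)"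
    using presentation by blast
  let ?w = "[(s, True), (s, True)]"
  have "m s s = enat 1"
    using m(1) assms by (simp add: coxeter_matrix_def one_enat_def)
  then have "?w \<in> coxeter_relators S m"
    using assms unfolding coxeter_relators_def by (intro CollectI exI[of _ s] exI[of _ 1]) simp
  from pres_relator[of "[]" S "[]", OF _ _ this]
  have "pres_eq S (coxeter_relators S m) ?w []" by simp
  moreover have "?w \<in> lists (S \<times> UNIV)" using assms by simp
  ultimately have "word_value W ?w = \<one>"
    using m(2) unfolding presented_by_def by blast
  then show ?thesis
    using generator_in_carrier[OF assms] by simp
qed

text \<open>Conjugation by the unit fixes \<open>s\<close>; this makes (QP1) applicable to
  generators.\<close>

lemma generator_reflection: "s \<in> S \<Longrightarrow> s \<in> reflections W S"
  unfolding reflections_def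
  using generator_in_carrier by (intro CollectI exI[of _ \<one>] exI[of _ s]) simp

end

text \<open>The diagonal entry at \<open>x\<close> of the matrix of the operator.\<close>

definition T_diag :: "('w \<Rightarrow> 'x \<Rightarrow> 'x) \<Rightarrow> ('x \<Rightarrow> int) \<Rightarrow> hecke_sign \<Rightarrow> 'w \<Rightarrow> 'x \<Rightarrow> int poly" where
  "T_diag act ht e s x =
     (if ht (act s x) > ht x then 0 else if ht (act s x) = ht x then eps e else q_poly - 1)"

text \<open>The coefficient of \<open>T(x)\<close> in the image of \<open>T(sx)\<close>, for \<open>sx \<noteq> x\<close>.\<close>

definition T_offdiag :: "('w \<Rightarrow> 'x \<Rightarrow> 'x) \<Rightarrow> ('x \<Rightarrow> int) \<Rightarrow> 'w \<Rightarrow> 'x \<Rightarrow> int poly" where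
  "T_offdiag act ht s x =
     (if ht (act s x) > ht x then q_poly else if ht (act s x) = ht x then 0 else 1)"

context quasiparabolic_W_set
begin

lemma act_generator_closed: "s \<in> S \<Longrightarrow> x \<in> X \<Longrightarrow> act s x \<in> X"
  using generator_in_carrier element_image by blast

lemma act_generator_involution:
  assumes "s \<in> S" "x \<in> X"
  shows "act s (act s x) = x"
  using composition_rule[of x s s] generator_in_carrier[of s] generator_square[of s]
    id_eq_one assms by (metis restrict_apply')

text \<open>If the heights of \<open>y\<close> and \<open>act s y\<close> agree, (QP1) gives
  \<open>act s y = y\<close> and both conditions become \<open>x = y\<close>;
  \<open>T_offdiag\<close> is then 0, so \<open>eps e\<close> is counted once.\<close>

lemma lookup_T_op_basis:
  assumes "s \<in> S" "x \<in> X" "y \<in> X"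
  shows "Poly_Mapping.lookup (T_op_basis act ht e s x) y
    = (if x = y then T_diag act ht e s y else 0)
      + (if x = act s y then T_offdiag act ht s y else 0)"
proof -
  have "act s x = y \<longleftrightarrow> x = act s y"
    using act_generator_involution assms by metis
  moreover have "act s y = y" if "ht (act s y) = ht y"
    using QP1 generator_reflection that assms by blast
  ultimately show ?thesis
    using act_generator_involution[of s y] assms
    by (auto simp: T_op_basis_def T_diag_def T_offdiag_def lookup_add lookup_T_basis)
qed

lemma lookup_T_op_eq:
  assumes "s \<in> S" "u \<in> T_module X" "y \<in> X"
  shows "Poly_Mapping.lookup (T_op act ht e s u) y
    = T_diag act ht e s y * Poly_Mapping.lookup u y
      + T_offdiag act ht s y * Poly_Mapping.lookup u (act s y)"
proof -
  \<comment> \<open>Adjoining \<open>y\<close> and \<open>act s y\<close> ensures that both deltas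
    are hit, even where \<open>u\<close> vanishes.\<close>
  let ?A = "insert y (insert (act s y) (Poly_Mapping.keys u))"
  have sub: "?A \<subseteq> X"
    using assms act_generator_closed by (auto simp: T_module_def)
  have "Poly_Mapping.lookup (T_op act ht e s u) y
      = (\<Sum>x\<in>?A. Poly_Mapping.lookup u x
        * Poly_Mapping.lookup (T_op_basis act ht e s x) y)"
    by (rule lookup_T_op) auto
  also have "\<dots> = (\<Sum>x\<in>?A. (if x = y then T_diag act ht e s y * Poly_Mapping.lookup u y else 0)
      + (if x = act s y then T_offdiag act ht s y * Poly_Mapping.lookup u (act s y) else 0))"
  proof (rule sum.cong[OF refl])
    fix x assume "x \<in> ?A"
    then have "x \<in> X" using sub by blast
    then show "Poly_Mapping.lookup u x * Poly_Mapping.lookup (T_op_basis act ht e s x) y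
      = (if x = y then T_diag act ht e s y * Poly_Mapping.lookup u y else 0)
      + (if x = act s y then T_offdiag act ht s y * Poly_Mapping.lookup u (act s y) else 0)"
      using assms by (auto simp: lookup_T_op_basis algebra_simps)
  qed
  also have "\<dots> = T_diag act ht e s y * Poly_Mapping.lookup u y
      + T_offdiag act ht s y * Poly_Mapping.lookup u (act s y)"
    unfolding sum.distrib by (simp only: sum.delta finite_insert finite_keys) simp
  finally show ?thesis .
qed

lemma T_offdiag_symmetric:
  assumes "s \<in> S" "x \<in> X"
  shows "to_laurent (T_offdiag act ht s (act s x)) * q_pow (ht (act s x))
    = to_laurent (T_offdiag act ht s x) * q_pow (ht x)"
proof -
  \<comment> \<open>Writing the larger height as \<open>1 +\<close> the smaller lets
    \<open>q_pow_add\<close> split off the factor \<open>q_pow 1\<close>, the image of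
    \<open>q_poly\<close>. At equal heights both sides vanish.\<close>
  consider "ht (act s x) = ht x" | "ht (act s x) = 1 + ht x" | "ht x = 1 + ht (act s x)"
    using ht_step[OF assms] by linarith
  then show ?thesis
    using act_generator_involution[OF assms]
    by cases (simp_all add: T_offdiag_def q_pow_add)
qed

text \<open>This separates a diagonal sum, visibly symmetric in \<open>u\<close> and
  \<open>v\<close>, from an off-diagonal sum still to be reindexed.\<close>

lemma pairing_T_op:
  assumes "s \<in> S" "u \<in> T_module X" "finite A" "A \<subseteq> X" "act s ` A = A" "Poly_Mapping.keys v \<subseteq> A"
  shows "pairing ht (T_op act ht e s u) v
    = (\<Sum>x\<in>A. to_laurent (T_diag act ht e s x) * to_laurent (Poly_Mapping.lookup u x)
        * to_laurent (Poly_Mapping.lookup v x) * q_pow (ht x))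
      + (\<Sum>x\<in>A. to_laurent (T_offdiag act ht s x) * q_pow (ht x)
        * to_laurent (Poly_Mapping.lookup u (act s x)) * to_laurent (Poly_Mapping.lookup v x))"
proof -
  have "pairing ht (T_op act ht e s u) v
      = (\<Sum>x\<in>A. to_laurent (Poly_Mapping.lookup v x)
        * to_laurent (Poly_Mapping.lookup (T_op act ht e s u) x) * q_pow (ht x))"
    \<comment> \<open>Commuting puts \<open>v\<close>, whose support lies in \<open>A\<close>,
      first, so the support of the image of \<open>u\<close> need not be known.\<close>
    unfolding pairing_commute[of _ "T_op act ht e s u"] using assms by (intro pairing_eq_left)
  also have "\<dots> = (\<Sum>x\<in>A. to_laurent (T_diag act ht e s x) * to_laurent (Poly_Mapping.lookup u x)
        * to_laurent (Poly_Mapping.lookup v x) * q_pow (ht x)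
      + to_laurent (T_offdiag act ht s x) * q_pow (ht x)
        * to_laurent (Poly_Mapping.lookup u (act s x)) * to_laurent (Poly_Mapping.lookup v x))"
    using assms by (intro sum.cong refl)
      (simp add: subset_iff lookup_T_op_eq to_laurent_add to_laurent_mult algebra_simps)
  finally show ?thesis
    by (simp add: sum.distrib)
qed

lemma T_op_self_adjoint:
  assumes s: "s \<in> S" and u: "u \<in> T_module X" and v: "v \<in> T_module X"
  shows "pairing ht (T_op act ht e s u) v = pairing ht u (T_op act ht e s v)"
proof -
  define K where "K = Poly_Mapping.keys u \<union> Poly_Mapping.keys v"
  \<comment> \<open>Closing \<open>K\<close> under the involution \<open>act s\<close> allows both
    sides to be summed over one stable set.\<close>
  define A where "A = K \<union> act s ` K"
  have K: "K \<subseteq> X" using u v by (auto simp: K_def T_module_def)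
  have A: "finite A" "A \<subseteq> X" "Poly_Mapping.keys u \<subseteq> A" "Poly_Mapping.keys v \<subseteq> A"
    using K act_generator_closed[OF s] by (auto simp: A_def K_def)
  have inv: "act s (act s x) = x" if "x \<in> A" for x
    using act_generator_involution[OF s] A(2) that by blast
  have "act s ` act s ` K = K"
    using inv by (force simp: A_def image_image)
  then have stable: "act s ` A = A"
    by (auto simp: A_def image_Un)
  \<comment> \<open>Substituting \<open>act s x\<close> for \<open>x\<close> preserves the weight by
    \<open>T_offdiag_symmetric\<close> and exchanges the roles of \<open>u\<close> and
    \<open>v\<close>.\<close>
  have "(\<Sum>x\<in>A. to_laurent (T_offdiag act ht s x) * q_pow (ht x)
        * to_laurent (Poly_Mapping.lookup u (act s x)) * to_laurent (Poly_Mapping.lookup v x))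
      = (\<Sum>x\<in>A. to_laurent (T_offdiag act ht s x) * q_pow (ht x)
        * to_laurent (Poly_Mapping.lookup v (act s x)) * to_laurent (Poly_Mapping.lookup u x))"
    using stable inv A(2) T_offdiag_symmetric[OF s]
    by (intro sum.reindex_bij_witness[of _ "act s" "act s"]) (auto simp: mult_ac)
  then have "pairing ht (T_op act ht e s u) v = pairing ht (T_op act ht e s v) u"
    using s u v A stable by (simp add: pairing_T_op[where A = A] mult_ac)
  then show ?thesis
    by (simp only: pairing_commute[of ht u])
qed

end

theorem proposition7p7:
  fixes W :: "('w, 'k) monoid_scheme" and S :: "'w set"
    and X :: "'x set" and act :: "'w \<Rightarrow> 'x \<Rightarrow> 'x" and ht :: "'x \<Rightarrow> int"
    and s :: 'w and e :: hecke_sign and u v :: "'x \<Rightarrow>\<^sub>0 int poly"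
  assumes "coxeter_system W S"
    and "quasiparabolic_W_set W S X act ht"
    and "s \<in> S"
    and "u \<in> T_module X" and "v \<in> T_module X"
  shows "pairing ht (T_op act ht e s u) v = pairing ht u (T_op act ht e s v)"
  using assms(2-) by (rule quasiparabolic_W_set.T_op_self_adjoint)

end
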